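(* Let $m\in\{2,3,\dots\}$, $k\in\{1,\dots,m\}$, $v\in(\mathbb{R}\setminus\{0\})^m$ and $g=(g_1,\dots,g_m)\sim\mathcal{N}(0,I_m)$. Let $\Sigma(g):=\sum_{j=1}^m\frac{g_jv_j}{\|v\|_2^2}$. Then $$ \mathbb{P}\left[\frac{g_l}{v_l}\le\Sigma(g)\ \text{for all }1\le l\le k\ \text{ and }\ \Sigma(g)\le\frac{g_r}{v_r}\ \text{for all }k+1\le r\le m\right] =\mathbb{E}\left[\prod_{l=1}^k\Phi\left(\frac{ig_1|v_l|}{\|v\|_2}\right)\prod_{r=k+1}^m\Phi\left(\frac{-ig_1|v_r|}{\|v\|_2}\right)\right]. $$
   Context: $i:=\sqrt{-1}$, $\|v\|_2^2=\sum_{j=1}^m v_j^2$, and $\Phi:\mathbb{C}\to\mathbb{C}$, $\Phi(z):=\frac12+\frac{1}{\sqrt{2\pi}}\int_0^ze^{-t^2/2}\,dt$. Empty products equal $1$. *)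

theory Defs
  imports "HOL-Probability.Probability" "HOL-Complex_Analysis.Complex_Analysis"
begin

text \<open>The integrand is entire, so the path from 0 to \<open>z\<close> is immaterial; we take the segment.\<close>

definition Phi :: "complex \<Rightarrow> complex" where
  "Phi z = 1 / 2 + 1 / complex_of_real (sqrt (2 * pi)) *
             contour_integral (linepath 0 z) (\<lambda>t. exp (- (t\<^sup>2) / 2))"

text \<open>\<open>(g 1, \<dots>, g m)\<close> is an \<open>N(0, I\<^sub>m)\<close> random vector on \<open>M\<close>.\<close>

definition std_gaussian_vector :: "'a measure \<Rightarrow> nat \<Rightarrow> (nat \<Rightarrow> 'a \<Rightarrow> real) \<Rightarrow> bool" where
  "std_gaussian_vector M m g \<longleftrightarrow>
     prob_space M \<and>
     prob_space.indep_vars M (\<lambda>_. borel) g {1..m} \<and>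
     (\<forall>j\<in>{1..m}. distributed M lborel (g j) std_normal_density)"

definition Sigma_avg :: "nat \<Rightarrow> (nat \<Rightarrow> real) \<Rightarrow> (nat \<Rightarrow> real) \<Rightarrow> real" where
  "Sigma_avg m v x = (\<Sum>j=1..m. x j * v j / (L2_set v {1..m})\<^sup>2)"

end

theory Submission
  imports Defs "HOL-Real_Asymp.Real_Asymp"
begin

text \<open>
  Let \<open>u = v / \<parallel>v\<parallel>\<close> and let \<open>T\<close> be the component of the Gaussian vector \<open>g\<close> along \<open>u\<close>; the event only
  depends on \<open>g - T u\<close>, which is independent of \<open>T\<close>, and says that this vector lies in an orthant \<open>C\<close>.
  By Cauchy's theorem \<open>exp (- y\<^sup>2 / 2) \<Phi>(i y)\<close> is the Fourier transform of the Gaussian measure on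
  a half-line, so \<open>exp (- y\<^sup>2 / 2)\<close> times the product of the \<open>\<Phi>\<close>-factors at \<open>y\<close> is
  \<open>\<psi>(y) = E[exp (- i y T); g \<in> C]\<close>. Each damped factor is \<open>O(1 / y)\<close> and there are at least two of
  them, hence \<open>\<psi>\<close> is integrable. Fourier inversion at \<open>0\<close>, done by Gaussian smoothing, identifies
  \<open>(2 \<pi>)\<^bsup>-1/2\<^esup> \<integral> \<psi>\<close> with \<open>P[g - T u \<in> C]\<close>: after smoothing at scale \<open>1 / n\<close> the integral becomes
  \<open>E[exp (- (r / n)\<^sup>2 / 2); g - T u + (r / n) u \<in> C]\<close> with \<open>r\<close> an independent standard normal variable,
  and almost surely \<open>g - T u\<close> is not on the boundary of \<open>C\<close>.
\<close>

subsection \<open>Translations of the standard Gaussian measure\<close>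

lemma prob_space_std_normal_distribution: "prob_space std_normal_distribution"
  using real_dist_normal_dist by (simp add: real_distribution_def)

text \<open>Completing the square gives \<open>std_normal_density (x - a) = std_normal_density x *
  exp (a * x - a^2 / 2)\<close>, so translating the variable amounts to inserting this exponential.
  It is the one-dimensional Cameron--Martin formula.\<close>

lemma nn_integral_std_normal_distribution_shift:
  assumes [measurable]: "f \<in> borel_measurable borel"
  shows "(\<integral>\<^sup>+x. f (x + a) \<partial>std_normal_distribution)
       = (\<integral>\<^sup>+x. f x * ennreal (exp (a * x - a\<^sup>2 / 2)) \<partial>std_normal_distribution)"
proof -
  have eq: "std_normal_density (x - a) = std_normal_density x * exp (a * x - a\<^sup>2 / 2)" for x
    by (simp add: std_normal_density_def flip: exp_add)
       (simp add: power2_eq_square field_simps)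
  have "(\<integral>\<^sup>+x. f (x + a) \<partial>std_normal_distribution)
      = (\<integral>\<^sup>+x. ennreal (std_normal_density x) * f (x + a) \<partial>lborel)"
    by (simp add: nn_integral_density)
  also have "\<dots> = (\<integral>\<^sup>+x. ennreal (std_normal_density (x - a)) * f x \<partial>lborel)"
    by (subst nn_integral_real_affine[where c = 1 and t = "- a"]) simp_all
  also have "\<dots> = (\<integral>\<^sup>+x. ennreal (std_normal_density x) *
      (f x * ennreal (exp (a * x - a\<^sup>2 / 2))) \<partial>lborel)"
    by (simp add: eq ennreal_mult mult_ac)
  finally show ?thesis
    by (simp add: nn_integral_density)
qed

abbreviation std_gauss :: "'i set \<Rightarrow> ('i \<Rightarrow> real) measure" where
  "std_gauss I \<equiv> PiM I (\<lambda>_. std_normal_distribution)"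

lemma prob_space_std_gauss: "prob_space (std_gauss I)"
  by (intro prob_space_PiM prob_space_std_normal_distribution)

lemma sets_std_gauss [measurable_cong]: "sets (std_gauss I) = sets (PiM I (\<lambda>_. borel))"
  by (intro sets_PiM_cong) simp_all

lemma space_std_gauss: "space (std_gauss I) = extensional I"
  by (simp add: space_PiM PiE_def)

text \<open>Both sides are the product of the one-dimensional translates \<open>?D j\<close>,
  because they agree on boxes: the preimage of a box under a translation is a box, and the
  exponential density factorises over the coordinates. Restricting the translated function to
  \<open>I\<close> keeps it in the extensional carrier of the product space.\<close>

lemma distr_std_gauss_shift:
  assumes I: "finite I"
  shows "distr (std_gauss I) (std_gauss I) (\<lambda>x. \<lambda>j\<in>I. x j + a j)
    = density (std_gauss I) (\<lambda>x. \<Prod>j\<in>I. ennreal (exp (a j * x j - (a j)\<^sup>2 / 2)))"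
proof -
  interpret N: prob_space std_normal_distribution
    by (rule prob_space_std_normal_distribution)
  interpret P: product_sigma_finite "\<lambda>_. std_normal_distribution" ..
  let ?e = "\<lambda>j x. ennreal (exp (a j * x - (a j)\<^sup>2 / 2))"
  let ?D = "\<lambda>j. density std_normal_distribution (?e j)"
  have D: "?D j = distr std_normal_distribution std_normal_distribution (\<lambda>x. x + a j)" for j
  proof (rule measure_eqI)
    fix A assume "A \<in> sets (?D j)"
    then have A [measurable]: "A \<in> sets borel" by simp
    have "emeasure (?D j) A = (\<integral>\<^sup>+x. indicator A x * ?e j x \<partial>std_normal_distribution)"
      by (simp add: emeasure_density mult.commute)
    also have "\<dots> = (\<integral>\<^sup>+x. indicator A (x + a j) \<partial>std_normal_distribution)"
      by (rule nn_integral_std_normal_distribution_shift [symmetric]) simp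
    also have "\<dots> = (\<integral>\<^sup>+x. indicator A x
        \<partial>distr std_normal_distribution std_normal_distribution (\<lambda>x. x + a j))"
      by (subst nn_integral_distr) simp_all
    finally show "emeasure (?D j) A =
        emeasure (distr std_normal_distribution std_normal_distribution (\<lambda>x. x + a j)) A"
      by simp
  qed simp
  have "prob_space (?D j)" for j
    unfolding D by (rule N.prob_space_distr) simp
  then interpret D: product_prob_space ?D
    by (simp add: product_prob_space_def product_prob_space_axioms_def product_sigma_finite_def
        prob_space_imp_sigma_finite)
  have "distr (std_gauss I) (std_gauss I) (\<lambda>x. \<lambda>j\<in>I. x j + a j) = PiM I ?D"
  proof (rule D.PiM_eqI [OF I])
    show "sets (distr (std_gauss I) (std_gauss I) (\<lambda>x. \<lambda>j\<in>I. x j + a j)) = sets (PiM I ?D)"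
      by (simp cong: sets_PiM_cong)
    fix A assume "\<And>i. i \<in> I \<Longrightarrow> A i \<in> sets (?D i)"
    then have A [measurable]: "\<And>i. i \<in> I \<Longrightarrow> A i \<in> sets borel" by simp
    have vim: "(\<lambda>x. \<lambda>j\<in>I. x j + a j) -` Pi\<^sub>E I A \<inter> space (std_gauss I)
        = (\<Pi>\<^sub>E j\<in>I. (\<lambda>x. x + a j) -` A j)"
      by (auto simp: space_std_gauss PiE_def Pi_def)
    have [measurable]: "(\<lambda>x. x + a j) -` A j \<in> sets borel" if "j \<in> I" for j
      using A[OF that] by (rule measurable_sets_borel[rotated]) simp
    have "emeasure (distr (std_gauss I) (std_gauss I) (\<lambda>x. \<lambda>j\<in>I. x j + a j)) (Pi\<^sub>E I A)
        = (\<Prod>j\<in>I. emeasure std_normal_distribution ((\<lambda>x. x + a j) -` A j))"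
      using I A by (subst emeasure_distr) (auto simp: vim intro!: P.emeasure_PiM sets_PiM_I_finite)
    also have "\<dots> = (\<Prod>j\<in>I. emeasure (?D j) (A j))"
      unfolding D by (intro prod.cong refl) (subst emeasure_distr, simp_all)
    finally show "emeasure (distr (std_gauss I) (std_gauss I) (\<lambda>x. \<lambda>j\<in>I. x j + a j)) (Pi\<^sub>E I A)
        = (\<Prod>j\<in>I. emeasure (?D j) (A j))" .
  qed
  also have "PiM I ?D = density (std_gauss I) (\<lambda>x. \<Prod>j\<in>I. ?e j (x j))"
  proof (rule D.PiM_eqI [OF I, symmetric])
    show "sets (density (std_gauss I) (\<lambda>x. \<Prod>j\<in>I. ?e j (x j))) = sets (PiM I ?D)"
      by (simp cong: sets_PiM_cong)
    fix A assume "\<And>i. i \<in> I \<Longrightarrow> A i \<in> sets (?D i)"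
    then have A [measurable]: "\<And>i. i \<in> I \<Longrightarrow> A i \<in> sets borel" by simp
    have "emeasure (density (std_gauss I) (\<lambda>x. \<Prod>j\<in>I. ?e j (x j))) (Pi\<^sub>E I A)
        = (\<integral>\<^sup>+x. (\<Prod>j\<in>I. ?e j (x j)) * indicator (Pi\<^sub>E I A) x \<partial>std_gauss I)"
      using I by (intro emeasure_density) (auto intro!: sets_PiM_I_finite)
    also have "\<dots> = (\<integral>\<^sup>+x. (\<Prod>j\<in>I. ?e j (x j) * indicator (A j) (x j)) \<partial>std_gauss I)"
    proof (rule nn_integral_cong)
      fix x assume "x \<in> space (std_gauss I)"
      then have "x \<in> extensional I" by (simp add: space_std_gauss)
      then have "indicator (Pi\<^sub>E I A) x = (\<Prod>j\<in>I. indicator (A j) (x j) :: ennreal)"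
        using I by (auto simp: indicator_def PiE_def Pi_def)
      then show "(\<Prod>j\<in>I. ?e j (x j)) * indicator (Pi\<^sub>E I A) x
          = (\<Prod>j\<in>I. ?e j (x j) * indicator (A j) (x j))"
        by (simp add: prod.distrib)
    qed
    also have "\<dots> = (\<Prod>j\<in>I. \<integral>\<^sup>+x. ?e j x * indicator (A j) x \<partial>std_normal_distribution)"
      using I by (intro P.product_nn_integral_prod) simp_all
    also have "\<dots> = (\<Prod>j\<in>I. emeasure (?D j) (A j))"
      by (intro prod.cong refl) (subst emeasure_density, simp_all)
    finally show "emeasure (density (std_gauss I) (\<lambda>x. \<Prod>j\<in>I. ?e j (x j))) (Pi\<^sub>E I A)
        = (\<Prod>j\<in>I. emeasure (?D j) (A j))" .
  qed
  finally show ?thesis .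
qed

text \<open>The Cameron--Martin formula in the form used for integrands: the product of exponentials
  is collected into a single exponential, which for \<open>a = r u\<close> with a unit vector
  \<open>u\<close> depends on \<open>x\<close> only through its component along
  \<open>u\<close>.\<close>

lemma nn_integral_std_gauss_shift:
  assumes I: "finite I" and H [measurable]: "H \<in> borel_measurable (PiM I (\<lambda>_. borel))"
  shows "(\<integral>\<^sup>+x. H (\<lambda>j\<in>I. x j + a j) \<partial>std_gauss I)
    = (\<integral>\<^sup>+x. H x * ennreal (exp ((\<Sum>j\<in>I. a j * x j) - (\<Sum>j\<in>I. (a j)\<^sup>2) / 2)) \<partial>std_gauss I)"
proof -
  have "(\<integral>\<^sup>+x. H (\<lambda>j\<in>I. x j + a j) \<partial>std_gauss I)
      = (\<integral>\<^sup>+x. H x \<partial>distr (std_gauss I) (std_gauss I) (\<lambda>x. \<lambda>j\<in>I. x j + a j))"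
    by (subst nn_integral_distr) simp_all
  also have "\<dots> = (\<integral>\<^sup>+x. (\<Prod>j\<in>I. ennreal (exp (a j * x j - (a j)\<^sup>2 / 2))) * H x \<partial>std_gauss I)"
    unfolding distr_std_gauss_shift [OF I] by (subst nn_integral_density) simp_all
  also have "\<dots> = (\<integral>\<^sup>+x. H x * ennreal (exp ((\<Sum>j\<in>I. a j * x j) - (\<Sum>j\<in>I. (a j)\<^sup>2) / 2)) \<partial>std_gauss I)"
    using I by (simp add: prod_ennreal exp_sum [symmetric] sum_subtractf sum_divide_distrib mult.commute)
  finally show ?thesis .
qed

section \<open>Splitting the Gaussian measure along a unit vector\<close>

definition proj_sum :: "'i set \<Rightarrow> ('i \<Rightarrow> real) \<Rightarrow> ('i \<Rightarrow> real) \<Rightarrow> real" where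
  "proj_sum I u x = (\<Sum>i\<in>I. u i * x i)"

lemma measurable_proj_sum [measurable]:
  "finite I \<Longrightarrow> proj_sum I u \<in> borel_measurable (PiM I (\<lambda>_. borel))"
  unfolding proj_sum_def by measurable

text \<open>Since \<open>u\<close> has length one, \<open>proj_sum I u x\<close> is the coordinate
  of \<open>x\<close> along \<open>u\<close>, and adding \<open>r u\<close> changes it by exactly
  \<open>r\<close>. Taking \<open>r = s - proj_sum I u x\<close> resets this coordinate to
  \<open>s\<close> and leaves the orthogonal component alone.\<close>

lemma proj_sum_shift:
  assumes "(\<Sum>j\<in>I. (u j)\<^sup>2) = 1"
  shows "proj_sum I u (\<lambda>j\<in>I. x j + r * u j) = proj_sum I u x + r"
proof -
  have "proj_sum I u (\<lambda>j\<in>I. x j + r * u j) = (\<Sum>j\<in>I. u j * x j + r * (u j)\<^sup>2)"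
    unfolding proj_sum_def by (intro sum.cong) (auto simp: algebra_simps power2_eq_square)
  also have "\<dots> = proj_sum I u x + r"
    using assms by (simp add: sum.distrib proj_sum_def flip: sum_distrib_left)
  finally show ?thesis .
qed

text \<open>Rotation invariance is avoided: substituting \<open>s = proj_sum I u x + r\<close> turns the inner integral
  into one over shifts by \<open>r u\<close>, whose Cameron--Martin density cancels the Gaussian weight.\<close>

lemma nn_integral_std_gauss_split:
  assumes I: "finite I" and u: "(\<Sum>j\<in>I. (u j)\<^sup>2) = 1"
    and H [measurable]: "H \<in> borel_measurable (PiM I (\<lambda>_. borel))"
  shows "(\<integral>\<^sup>+x. \<integral>\<^sup>+s. H (\<lambda>j\<in>I. x j + (s - proj_sum I u x) * u j) \<partial>std_normal_distribution \<partial>std_gauss I)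
    = (\<integral>\<^sup>+x. H x \<partial>std_gauss I)"
proof -
  note [measurable] = measurable_proj_sum [OF I]
  let ?\<phi> = "\<lambda>t. ennreal (std_normal_density t)" and ?T = "proj_sum I u"
  interpret N: prob_space std_normal_distribution
    by (rule prob_space_std_normal_distribution)
  interpret P: prob_space "std_gauss I"
    by (rule prob_space_std_gauss)
  interpret pair_sigma_finite "std_gauss I" lborel ..
  have T_shift: "?T (\<lambda>j\<in>I. x j + r * u j) = ?T x + r" for x r
    by (rule proj_sum_shift [OF u])
  have "(\<integral>\<^sup>+x. \<integral>\<^sup>+s. H (\<lambda>j\<in>I. x j + (s - ?T x) * u j) \<partial>std_normal_distribution \<partial>std_gauss I)
      = (\<integral>\<^sup>+x. \<integral>\<^sup>+s. ?\<phi> s * H (\<lambda>j\<in>I. x j + (s - ?T x) * u j) \<partial>lborel \<partial>std_gauss I)"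
    by (intro nn_integral_cong nn_integral_density) (simp_all cong: measurable_cong_sets)
  also have "\<dots> = (\<integral>\<^sup>+x. \<integral>\<^sup>+r. ?\<phi> (?T x + r) * H (\<lambda>j\<in>I. x j + r * u j) \<partial>lborel \<partial>std_gauss I)"
  proof (rule nn_integral_cong)
    fix x
    show "(\<integral>\<^sup>+s. ?\<phi> s * H (\<lambda>j\<in>I. x j + (s - ?T x) * u j) \<partial>lborel)
        = (\<integral>\<^sup>+r. ?\<phi> (?T x + r) * H (\<lambda>j\<in>I. x j + r * u j) \<partial>lborel)"
      by (subst nn_integral_real_affine [where c = 1 and t = "?T x"]) simp_all
  qed
  also have "\<dots> = (\<integral>\<^sup>+r. \<integral>\<^sup>+x. ?\<phi> (?T x + r) * H (\<lambda>j\<in>I. x j + r * u j) \<partial>std_gauss I \<partial>lborel)"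
    by (rule Fubini' [symmetric]) measurable
  \<comment> \<open>For fixed \<open>r\<close>, Cameron--Martin is applied to
    \<open>?\<phi> (?T x) * H x\<close>; by \<open>T_shift\<close> its translate by
    \<open>r u\<close> is the integrand on the left.\<close>
  also have "\<dots> = (\<integral>\<^sup>+r. \<integral>\<^sup>+x. ?\<phi> (?T x) * H x * ennreal (exp (r * ?T x - r\<^sup>2 / 2)) \<partial>std_gauss I \<partial>lborel)"
  proof (rule nn_integral_cong)
    fix r :: real
    have *: "(\<Sum>j\<in>I. r * u j * x j) = r * ?T x" "(\<Sum>j\<in>I. (r * u j)\<^sup>2) = r\<^sup>2" for x
      using u by (simp_all add: proj_sum_def sum_distrib_left mult_ac power_mult_distrib flip: sum_distrib_left)
    show "(\<integral>\<^sup>+x. ?\<phi> (?T x + r) * H (\<lambda>j\<in>I. x j + r * u j) \<partial>std_gauss I)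
        = (\<integral>\<^sup>+x. ?\<phi> (?T x) * H x * ennreal (exp (r * ?T x - r\<^sup>2 / 2)) \<partial>std_gauss I)"
      using nn_integral_std_gauss_shift [OF I, of "\<lambda>x. ?\<phi> (?T x) * H x" "\<lambda>j. r * u j"]
      by (simp add: T_shift *)
  qed
  also have "\<dots> = (\<integral>\<^sup>+x. \<integral>\<^sup>+r. ?\<phi> (?T x) * H x * ennreal (exp (r * ?T x - r\<^sup>2 / 2)) \<partial>lborel \<partial>std_gauss I)"
    by (rule Fubini') measurable
  also have "\<dots> = (\<integral>\<^sup>+x. H x \<partial>std_gauss I)"
  proof (rule nn_integral_cong)
    fix x
    have "?\<phi> (?T x) * H x * ennreal (exp (r * ?T x - r\<^sup>2 / 2)) = H x * ?\<phi> (r - ?T x)" for r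
    proof -
      \<comment> \<open>Completing the square once more leaves a normal density in \<open>r\<close>
        centred at \<open>?T x\<close>, whose total mass is 1.\<close>
      have "std_normal_density (?T x) * exp (r * ?T x - r\<^sup>2 / 2) = std_normal_density (r - ?T x)"
        by (simp add: std_normal_density_def flip: exp_add)
           (simp add: power2_eq_square field_simps)
      then show ?thesis
        by (simp add: mult_ac flip: ennreal_mult)
    qed
    then have "(\<integral>\<^sup>+r. ?\<phi> (?T x) * H x * ennreal (exp (r * ?T x - r\<^sup>2 / 2)) \<partial>lborel)
        = H x * (\<integral>\<^sup>+r. ?\<phi> (r - ?T x) \<partial>lborel)"
      by (simp add: nn_integral_cmult)
    also have "(\<integral>\<^sup>+r. ?\<phi> (r - ?T x) \<partial>lborel) = (\<integral>\<^sup>+r. ?\<phi> r \<partial>lborel)"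
      by (subst nn_integral_real_affine [where c = 1 and t = "?T x"]) simp_all
    also have "\<dots> = 1"
      using N.emeasure_space_1 by (simp add: emeasure_density)
    finally show "(\<integral>\<^sup>+r. ?\<phi> (?T x) * H x * ennreal (exp (r * ?T x - r\<^sup>2 / 2)) \<partial>lborel) = H x"
      by simp
  qed
  finally show ?thesis .
qed

subsection \<open>The normal distribution function on the imaginary axis\<close>

text \<open>An entire function on the convex set \<open>UNIV\<close> has a primitive. Working with
  \<open>G\<close> replaces contour integrals by differences of values, so any path may be used
  below.\<close>

lemma Phi_primitive:
  obtains G :: "complex \<Rightarrow> complex"
  where "\<And>z. (G has_field_derivative exp (- (z\<^sup>2) / 2)) (at z)"
    and "\<And>z. Phi z = 1 / 2 + (G z - G 0) / complex_of_real (sqrt (2 * pi))"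
proof -
  have "(\<lambda>z::complex. exp (- (z\<^sup>2) / 2)) holomorphic_on UNIV"
    by (intro holomorphic_intros) auto
  then obtain G :: "complex \<Rightarrow> complex"
    where "\<And>z. z \<in> UNIV \<Longrightarrow> (G has_field_derivative exp (- (z\<^sup>2) / 2)) (at z within UNIV)"
    using holomorphic_convex_primitive' [OF convex_UNIV open_UNIV] by metis
  then have G: "(G has_field_derivative exp (- (z\<^sup>2) / 2)) (at z)" for z
    by (simp only: UNIV_I)
  have "contour_integral (linepath 0 z) (\<lambda>t. exp (- (t\<^sup>2) / 2)) = G z - G 0" for z
    using contour_integral_primitive [of UNIV G "\<lambda>t. exp (- (t\<^sup>2) / 2)" "linepath 0 z"] G
    by (simp add: contour_integral_unique)
  then show ?thesis
    using that [of G, OF G] by (simp add: Phi_def)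
qed

lemma integrable_std_normal_density: "integrable lborel std_normal_density"
  using integrable_std_normal_moment [of 0] by simp

text \<open>The density is even, the origin is a null set and the total mass is 1. The value is the
  additive constant in \<open>Phi\<close>.\<close>

lemma std_normal_half_line: "(LINT x:{..0}|lborel. std_normal_density x) = 1 / 2"
proof -
  have i [simp]: "set_integrable lborel A std_normal_density" if "A \<in> sets borel" for A :: "real set"
    unfolding set_integrable_def
    by (rule integrable_mult_indicator) (simp_all add: that integrable_std_normal_density)
  have "(LINT x:{..0}|lborel. std_normal_density x) = (LINT x:{0..}|lborel. std_normal_density x)"
    unfolding set_lebesgue_integral_def
    by (subst lborel_integral_real_affine [where c = "-1" and t = 0])
       (auto simp: std_normal_density_def indicator_def intro!: Bochner_Integration.integral_cong)
  moreover have "(LINT x:{0..}|lborel. std_normal_density x) = (LINT x:{0<..}|lborel. std_normal_density x)"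
  proof -
    have "AE x in lborel. x \<noteq> (0::real)" by (rule AE_lborel_singleton)
    then show ?thesis unfolding set_lebesgue_integral_def
      by (intro integral_cong_AE) (auto simp: indicator_def)
  qed
  moreover have "(LINT x:{..0}|lborel. std_normal_density x) + (LINT x:{0<..}|lborel. std_normal_density x)
      = (LINT x:{..0} \<union> {0<..}|lborel. std_normal_density x)"
    by (rule set_integral_Un [symmetric]) auto
  moreover have "{..0} \<union> {0<..} = (UNIV :: real set)" by auto
  moreover have "(LINT x|lborel. std_normal_density x) = 1"
    using integral_std_normal_moment_even [of 0] by simp
  ultimately show ?thesis
    by (simp add: set_lebesgue_integral_def)
qed

text \<open>Moves the path of integration from the half-line \<open>]-\<infinity>, 0]\<close> to its translate by \<open>\<i> y\<close>.\<close>

lemma Phi_imaginary: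
  "Phi (\<i> * complex_of_real y) * complex_of_real (exp (- (y\<^sup>2) / 2)) =
    (LINT x|std_normal_distribution. indicator {..0} x *\<^sub>R exp (- (\<i> * complex_of_real (y * x))))"
proof -
  obtain G where G: "\<And>z. (G has_field_derivative exp (- (z\<^sup>2) / 2)) (at z)"
    and Phi: "\<And>z. Phi z = 1 / 2 + (G z - G 0) / complex_of_real (sqrt (2 * pi))"
    by (rule Phi_primitive) blast
  define c where "c = complex_of_real (sqrt (2 * pi))"
  have c: "c \<noteq> 0" by (simp add: c_def)
  \<comment> \<open>The normal density continued to the point \<open>x + \<i> y\<close>. Expanding
    the square shows that on the horizontal line at height \<open>y\<close> it is the Fourier kernel
    times the density, up to the factor \<open>exp (y^2 / 2)\<close>.\<close>
  define f where "f y x = exp (- ((complex_of_real x + \<i> * complex_of_real y)\<^sup>2) / 2) / c" for x y :: real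
  have f_eq: "f y x = complex_of_real (exp (y\<^sup>2 / 2)) *
      (std_normal_density x *\<^sub>R exp (- (\<i> * complex_of_real (y * x))))" for x y
  proof -
    have "- ((complex_of_real x + \<i> * complex_of_real y)\<^sup>2) / 2
        = complex_of_real (y\<^sup>2 / 2) + complex_of_real (- x\<^sup>2 / 2) + (- (\<i> * complex_of_real (y * x)))"
      by (simp add: power2_eq_square field_simps)
    then have "exp (- ((complex_of_real x + \<i> * complex_of_real y)\<^sup>2) / 2) = complex_of_real (exp (y\<^sup>2 / 2)) *
        complex_of_real (exp (- x\<^sup>2 / 2)) * exp (- (\<i> * complex_of_real (y * x)))"
      by (simp only: exp_add exp_of_real)
    then show ?thesis
      unfolding f_def c_def std_normal_density_def scaleR_conv_of_real by simp
  qed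
  have cont: "isCont (f y) x" for x y
    unfolding f_def using c by (intro continuous_intros) auto
  have int: "set_integrable lborel A (f y)" if "A \<in> sets borel" for A y
    unfolding set_integrable_def
  proof (rule Bochner_Integration.integrable_bound)
    show "integrable lborel (\<lambda>x. exp (y\<^sup>2 / 2) * std_normal_density x)"
      using integrable_std_normal_density by simp
    show "(\<lambda>x. indicator A x *\<^sub>R f y x) \<in> borel_measurable lborel"
      unfolding f_eq using that by measurable
    show "AE x in lborel. norm (indicator A x *\<^sub>R f y x) \<le> norm (exp (y\<^sup>2 / 2) * std_normal_density x)"
      by (intro AE_I2) (auto simp: f_eq norm_mult indicator_def)
  qed
  have deriv: "((\<lambda>x. G (complex_of_real x + \<i> * complex_of_real y) / c) has_vector_derivative f y x) (at x)" for x y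
  proof -
    have "((\<lambda>w. G (w + \<i> * complex_of_real y) / c) has_field_derivative f y x) (at (complex_of_real x))"
      unfolding f_def
      by (rule DERIV_cdivide, rule DERIV_chain2 [OF G, where Db = 1, unfolded mult_1_right])
         (auto intro!: derivative_eq_intros)
    then show ?thesis
      by (rule has_vector_derivative_real_field)
  qed
  \<comment> \<open>A primitive of \<open>f y\<close> along the line at height \<open>y\<close>, so
    that the half-line integral is \<open>K y 0\<close> minus the limit of \<open>K y\<close> at
    minus infinity.\<close>
  define K where "K y x = G (complex_of_real x + \<i> * complex_of_real y) / c" for x y
  have lim: "(K y \<longlongrightarrow> K y 0 - (LINT x:{..0}|lborel. f y x)) at_bot" for y
  proof -
    have "((\<lambda>x. K y 0 - (LINT x:{x..0}|lborel. f y x)) \<longlongrightarrow> K y 0 - (LINT x:{..0}|lborel. f y x)) at_bot"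
      by (intro tendsto_diff tendsto_const tendsto_set_lebesgue_integral_at_bot int) simp_all
    moreover have "\<forall>\<^sub>F x in at_bot. K y 0 - (LINT x:{x..0}|lborel. f y x) = K y x"
      using eventually_le_at_bot [of 0]
    proof eventually_elim
      case (elim x)
      have "(LINT x:{x..0}|lborel. f y x) = K y 0 - K y x"
        unfolding set_lebesgue_integral_def
        by (rule integral_FTC_atLeastAtMost [OF elim])
           (auto simp: K_def intro!: deriv [THEN has_vector_derivative_at_within] continuous_at_imp_continuous_on cont)
      then show ?case by simp
    qed
    ultimately show ?thesis by (rule Lim_transform_eventually)
  qed
  \<comment> \<open>The vertical side of the contour: it has length \<open>\<bar>y\<bar>\<close>,
    and the integrand on it is at most \<open>exp (y^2 / 2 - x^2 / 2)\<close> in norm, so its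
    contribution vanishes as \<open>x\<close> tends to minus infinity.\<close>
  have "((\<lambda>x. K y x - K 0 x) \<longlongrightarrow> 0) at_bot"
  proof (rule Lim_null_comparison)
    show "\<forall>\<^sub>F x in at_bot. norm (K y x - K 0 x) \<le> exp (y\<^sup>2 / 2 - x\<^sup>2 / 2) * \<bar>y\<bar> / norm c"
    proof (intro always_eventually allI)
      fix x :: real
      let ?S = "closed_segment (complex_of_real x + \<i> * complex_of_real y) (complex_of_real x)"
      have "norm (G (complex_of_real x + \<i> * complex_of_real y) - G (complex_of_real x))
          \<le> exp (y\<^sup>2 / 2 - x\<^sup>2 / 2) * norm (complex_of_real x + \<i> * complex_of_real y - complex_of_real x)"
      proof (rule field_differentiable_bound [where S = ?S])
        fix z assume z: "z \<in> ?S"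
        then obtain t where t: "0 \<le> t" "t \<le> 1" and
            "z = (1 - t) *\<^sub>R (complex_of_real x + \<i> * complex_of_real y) + t *\<^sub>R complex_of_real x"
          by (auto simp: closed_segment_def)
        then have Re: "Re z = x" and Im: "Im z = (1 - t) * y"
          by (simp_all add: left_diff_distrib)
        have "((1 - t) * y)\<^sup>2 \<le> y\<^sup>2"
          using t by (intro abs_le_square_iff [THEN iffD1]) (simp add: abs_mult mult_left_le_one_le)
        then show "norm (exp (- (z\<^sup>2) / 2)) \<le> exp (y\<^sup>2 / 2 - x\<^sup>2 / 2)"
          using Re unfolding Im [symmetric] by (simp add: norm_exp_eq_Re Re_power2 diff_divide_distrib divide_right_mono)
        show "(G has_field_derivative exp (- (z\<^sup>2) / 2)) (at z within ?S)"
          by (rule G [THEN has_field_derivative_at_within])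
      qed simp_all
      then show "norm (K y x - K 0 x) \<le> exp (y\<^sup>2 / 2 - x\<^sup>2 / 2) * \<bar>y\<bar> / norm c"
        using c by (simp add: K_def norm_mult norm_divide divide_right_mono flip: diff_divide_distrib)
    qed
    show "((\<lambda>x. exp (y\<^sup>2 / 2 - x\<^sup>2 / 2) * \<bar>y\<bar> / norm c) \<longlongrightarrow> 0) at_bot"
    proof -
      have "((\<lambda>x. exp (a - x\<^sup>2 / 2)) \<longlongrightarrow> 0) at_bot" for a :: real
        by real_asymp
      then show ?thesis
        by (intro tendsto_divide_zero tendsto_mult_left_zero)
    qed
  qed
  moreover have "((\<lambda>x. K y x - K 0 x) \<longlongrightarrow> (K y 0 - (LINT x:{..0}|lborel. f y x)) -
      (K 0 0 - (LINT x:{..0}|lborel. f 0 x))) at_bot"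
    by (intro tendsto_diff lim)
  \<comment> \<open>The primitives at heights \<open>y\<close> and 0 thus have the same limit. As
    the integral of \<open>f 0\<close> is 1/2, the integral of \<open>f y\<close> is
    \<open>1 / 2 + K y 0 - K 0 0\<close>, which is \<open>Phi (\<i> y)\<close>.\<close>
  ultimately have "(K y 0 - (LINT x:{..0}|lborel. f y x)) - (K 0 0 - (LINT x:{..0}|lborel. f 0 x)) = 0"
    using tendsto_unique trivial_limit_at_bot_linorder by blast
  moreover have "(LINT x:{..0}|lborel. f 0 x) = 1 / 2"
  proof -
    have "(LINT x:{..0}|lborel. f 0 x) = (LINT x|lborel. complex_of_real (indicator {..0} x *\<^sub>R std_normal_density x))"
      unfolding set_lebesgue_integral_def
      by (intro Bochner_Integration.integral_cong) (auto simp: f_eq scaleR_conv_of_real)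
    also have "\<dots> = complex_of_real (LINT x:{..0}|lborel. std_normal_density x)"
      unfolding set_lebesgue_integral_def by (rule integral_complex_of_real)
    finally show ?thesis
      by (simp add: std_normal_half_line)
  qed
  ultimately have "Phi (\<i> * complex_of_real y) = (LINT x:{..0}|lborel. f y x)"
    unfolding Phi c_def [symmetric] by (simp add: K_def diff_divide_distrib algebra_simps)
  also have "\<dots> = complex_of_real (exp (y\<^sup>2 / 2)) * (LINT x|lborel. std_normal_density x *\<^sub>R
      (indicator {..0} x *\<^sub>R exp (- (\<i> * complex_of_real (y * x)))))"
    unfolding set_lebesgue_integral_def f_eq
    by (simp flip: integral_mult_right_zero) (simp add: mult_ac scaleR_conv_of_real)
  also have "(LINT x|lborel. std_normal_density x *\<^sub>R (indicator {..0} x *\<^sub>R exp (- (\<i> * complex_of_real (y * x)))))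
      = (LINT x|std_normal_distribution. indicator {..0} x *\<^sub>R exp (- (\<i> * complex_of_real (y * x))))"
    by (subst integral_density) simp_all
  finally show ?thesis
    by (simp add: mult_ac flip: of_real_mult exp_add)
qed

section \<open>Bounds for the damped values of \<open>Phi\<close> on the imaginary axis\<close>

lemma norm_Phi_imaginary_le_1:
  "norm (Phi (\<i> * complex_of_real y) * complex_of_real (exp (- (y\<^sup>2) / 2))) \<le> 1" (is "norm ?A \<le> 1")
proof -
  interpret N: prob_space std_normal_distribution
    by (rule prob_space_std_normal_distribution)
  \<comment> \<open>The damped value is the Fourier transform of a measure of mass at most
    1.\<close>
  have "norm ?A \<le> (LINT x|std_normal_distribution. norm (indicator {..0} x *\<^sub>R exp (- (\<i> * complex_of_real (y * x)))))"
    unfolding Phi_imaginary by (rule integral_norm_bound)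
  also have "\<dots> \<le> (LINT x|std_normal_distribution. 1)"
    by (intro integral_mono N.integrable_const_bound [where B = 1] AE_I2) (auto simp: indicator_def)
  also have "\<dots> = 1"
    using N.prob_space by simp
  finally show ?thesis .
qed

text \<open>On the segment from 0 to \<open>\<i> y\<close> the Gaussian grows, and its integral has
  size \<open>exp (y^2 / 2) / \<bar>y\<bar>\<close> up to a constant. The damping cancels the
  exponential, while the constant 1/2 in \<open>Phi\<close> only contributes a Gaussian
  tail.\<close>

lemma norm_Phi_imaginary_le:
  assumes y: "y \<noteq> 0"
  shows "norm (Phi (\<i> * complex_of_real y) * complex_of_real (exp (- (y\<^sup>2) / 2))) \<le> 2 / \<bar>y\<bar>"
    (is "norm ?A \<le> _")
proof -
  obtain G where G: "\<And>z. (G has_field_derivative exp (- (z\<^sup>2) / 2)) (at z)"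
    and Phi: "\<And>z. Phi z = 1 / 2 + (G z - G 0) / complex_of_real (sqrt (2 * pi))"
    by (rule Phi_primitive) blast
  have "((\<lambda>t. exp (y\<^sup>2 * t\<^sup>2 / 2) *\<^sub>R (\<i> * complex_of_real y)) has_integral
      G (\<i> * complex_of_real (y * 1)) - G (\<i> * complex_of_real (y * 0))) {0..1}"
  proof (rule fundamental_theorem_of_calculus)
    fix t :: real
    have "((\<lambda>w. G (\<i> * complex_of_real y * w)) has_field_derivative
        exp (- ((\<i> * complex_of_real y * complex_of_real t)\<^sup>2) / 2) * (\<i> * complex_of_real y)) (at (complex_of_real t))"
      by (rule DERIV_chain2 [OF G]) (auto intro!: derivative_eq_intros)
    then have "((\<lambda>t. G (\<i> * complex_of_real y * complex_of_real t)) has_vector_derivative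
        exp (- ((\<i> * complex_of_real y * complex_of_real t)\<^sup>2) / 2) * (\<i> * complex_of_real y)) (at t within {0..1})"
      by (rule has_vector_derivative_at_within [OF has_vector_derivative_real_field])
    moreover have "- ((\<i> * complex_of_real y * complex_of_real t)\<^sup>2) / 2 = complex_of_real (y\<^sup>2 * t\<^sup>2 / 2)"
      by (simp add: power_mult_distrib)
    ultimately show "((\<lambda>t. G (\<i> * complex_of_real (y * t))) has_vector_derivative
        exp (y\<^sup>2 * t\<^sup>2 / 2) *\<^sub>R (\<i> * complex_of_real y)) (at t within {0..1})"
      by (simp only: exp_of_real scaleR_conv_of_real of_real_mult mult_ac)
  qed simp
  then have 1: "((\<lambda>t. exp (y\<^sup>2 * t\<^sup>2 / 2) *\<^sub>R (\<i> * complex_of_real y)) has_integral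
      G (\<i> * complex_of_real y) - G 0) {0..1}" by simp
  \<comment> \<open>Replacing \<open>t^2\<close> by the larger \<open>t\<close> on
    \<open>{0..1}\<close> gives a majorant with an elementary primitive.\<close>
  have "((\<lambda>t. \<bar>y\<bar> * exp (y\<^sup>2 * t / 2)) has_integral
      2 / \<bar>y\<bar> * exp (y\<^sup>2 * 1 / 2) - 2 / \<bar>y\<bar> * exp (y\<^sup>2 * 0 / 2)) {0..1}"
  proof (rule fundamental_theorem_of_calculus)
    fix t :: real
    have "((\<lambda>t. 2 / \<bar>y\<bar> * exp (y\<^sup>2 * t / 2)) has_real_derivative
        2 / \<bar>y\<bar> * (exp (y\<^sup>2 * t / 2) * (y\<^sup>2 / 2))) (at t within {0..1})"
      by (intro DERIV_cmult) (auto intro!: derivative_eq_intros)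
    moreover have "2 / \<bar>y\<bar> * (exp (y\<^sup>2 * t / 2) * (y\<^sup>2 / 2)) = \<bar>y\<bar> * exp (y\<^sup>2 * t / 2)"
    proof -
      have "2 / c * (e * (c\<^sup>2 / 2)) = c * e" if "c \<noteq> 0" for c e :: real
        using that by (simp add: power2_eq_square)
      from this [of "\<bar>y\<bar>"] show ?thesis
        using y by simp
    qed
    ultimately show "((\<lambda>t. 2 / \<bar>y\<bar> * exp (y\<^sup>2 * t / 2)) has_vector_derivative
        \<bar>y\<bar> * exp (y\<^sup>2 * t / 2)) (at t within {0..1})"
      by (simp flip: has_real_derivative_iff_has_vector_derivative)
  qed simp
  then have 2: "((\<lambda>t. \<bar>y\<bar> * exp (y\<^sup>2 * t / 2)) has_integral 2 / \<bar>y\<bar> * (exp (y\<^sup>2 / 2) - 1)) {0..1}"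
    by (simp add: right_diff_distrib)
  have "norm (G (\<i> * complex_of_real y) - G 0) \<le> 2 / \<bar>y\<bar> * (exp (y\<^sup>2 / 2) - 1)"
  proof -
    have "norm (exp (y\<^sup>2 * t\<^sup>2 / 2) *\<^sub>R (\<i> * complex_of_real y)) \<le> \<bar>y\<bar> * exp (y\<^sup>2 * t / 2)"
      if "t \<in> {0..1}" for t
    proof -
      have "t\<^sup>2 \<le> t" using that by (simp add: power2_eq_square mult_left_le_one_le)
      then have "y\<^sup>2 * t\<^sup>2 \<le> y\<^sup>2 * t" by (rule mult_left_mono) simp
      then show ?thesis by (simp add: norm_mult mult.commute mult_left_mono)
    qed
    then show ?thesis
      using integral_norm_bound_integral [OF has_integral_integrable [OF 1] has_integral_integrable [OF 2]]
      unfolding integral_unique [OF 1] integral_unique [OF 2] by blast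
  qed
  also have "\<dots> \<le> 2 / \<bar>y\<bar> * exp (y\<^sup>2 / 2)"
    by (intro mult_left_mono) auto
  finally have G_le: "norm (G (\<i> * complex_of_real y) - G 0) \<le> 2 / \<bar>y\<bar> * exp (y\<^sup>2 / 2)" .
  have sqrt_ge: "2 \<le> sqrt (2 * pi)"
    using pi_ge_two by (intro real_le_rsqrt) simp
  have "norm ((G (\<i> * complex_of_real y) - G 0) / complex_of_real (sqrt (2 * pi)))
      = norm (G (\<i> * complex_of_real y) - G 0) / sqrt (2 * pi)"
    by (simp add: norm_divide)
  also have "\<dots> \<le> (2 / \<bar>y\<bar> * exp (y\<^sup>2 / 2)) / 2"
    by (intro frac_le G_le sqrt_ge) auto
  finally have "norm (Phi (\<i> * complex_of_real y)) \<le> 1 / 2 + exp (y\<^sup>2 / 2) / \<bar>y\<bar>"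
    unfolding Phi by (intro norm_triangle_le add_mono) auto
  then have "norm ?A \<le> (1 / 2 + exp (y\<^sup>2 / 2) / \<bar>y\<bar>) * exp (- (y\<^sup>2) / 2)"
    by (simp add: norm_mult mult_right_mono)
  also have "\<dots> = exp (- (y\<^sup>2) / 2) / 2 + 1 / \<bar>y\<bar>"
    by (simp add: exp_minus field_simps)
  \<comment> \<open>From \<open>\<bar>y\<bar> \<le> 1 + y^2 / 2\<close> and
    \<open>1 + s \<le> exp s\<close>. The total is then 3/2 over \<open>\<bar>y\<bar>\<close>,
    rounded up to 2.\<close>
  also have "exp (- (y\<^sup>2) / 2) \<le> 1 / \<bar>y\<bar>"
  proof -
    have "2 * \<bar>y\<bar> \<le> y\<^sup>2 + 1"
      using sum_squares_bound [of "\<bar>y\<bar>" 1] by simp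
    then have "\<bar>y\<bar> \<le> 1 + y\<^sup>2 / 2"
      using zero_le_power2 [of y] by linarith
    also have "\<dots> \<le> exp (y\<^sup>2 / 2)"
      by (rule exp_ge_add_one_self)
    finally show ?thesis
      using y by (simp add: exp_minus field_simps)
  qed
  also have "1 / \<bar>y\<bar> / 2 + 1 / \<bar>y\<bar> \<le> 2 / \<bar>y\<bar>"
    using y by (simp add: field_simps)
  finally show ?thesis
    by simp
qed

subsection \<open>Fourier inversion\<close>

text \<open>The reflection \<open>x \<mapsto> d x\<close> preserves the normal density and moves the
  sign \<open>d\<close> from the frequency to the half-line. This treats the factors with
  \<open>\<i>\<close> and with \<open>- \<i>\<close>, and both signs of the coordinates of
  \<open>u\<close>, at once.\<close>

lemma Phi_signed_imaginary:
  assumes "\<bar>d\<bar> = 1"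
  shows "Phi (\<i> * complex_of_real (d * a)) * complex_of_real (exp (- (a\<^sup>2) / 2)) =
    (LINT x|std_normal_distribution. indicator {..0} (d * x) *\<^sub>R exp (- (\<i> * complex_of_real (a * x))))"
proof -
  have d: "d = 1 \<or> d = -1" using assms by auto
  let ?f = "\<lambda>x. indicator {..0} x *\<^sub>R exp (- (\<i> * complex_of_real (d * a * x)))"
  have "Phi (\<i> * complex_of_real (d * a)) * complex_of_real (exp (- (a\<^sup>2) / 2))
      = (LINT x|std_normal_distribution. ?f x)"
    using Phi_imaginary [of "d * a"] d by auto
  also have "\<dots> = (LINT x|lborel. std_normal_density x *\<^sub>R ?f x)"
    by (rule integral_density) simp_all
  also have "\<dots> = (LINT x|lborel. std_normal_density (d * x) *\<^sub>R ?f (d * x))"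
    using d by (subst lborel_integral_real_affine [where c = d and t = 0]) auto
  also have "\<dots> = (LINT x|lborel. std_normal_density x *\<^sub>R
      (indicator {..0} (d * x) *\<^sub>R exp (- (\<i> * complex_of_real (a * x)))))"
    using d by (intro Bochner_Integration.integral_cong) (auto simp: std_normal_density_def)
  also have "\<dots> = (LINT x|std_normal_distribution.
      indicator {..0} (d * x) *\<^sub>R exp (- (\<i> * complex_of_real (a * x))))"
    by (rule integral_density [symmetric]) simp_all
  finally show ?thesis .
qed

lemma continuous_on_Phi: "continuous_on UNIV Phi"
proof -
  obtain G where G: "\<And>z. (G has_field_derivative exp (- (z\<^sup>2) / 2)) (at z)"
    and Phi: "\<And>z. Phi z = 1 / 2 + (G z - G 0) / complex_of_real (sqrt (2 * pi))"
    by (rule Phi_primitive) blast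
  have "continuous_on UNIV G"
    using G by (intro continuous_at_imp_continuous_on ballI DERIV_isCont) blast
  then show ?thesis
    unfolding Phi by (intro continuous_intros) auto
qed

lemma borel_measurable_Phi [measurable]: "Phi \<in> borel_measurable borel"
  by (rule borel_measurable_continuous_onI [OF continuous_on_Phi])

text \<open>The combination is normal with variance the sum of the squares of the
  \<open>c i\<close>, which is positive, so its law has a density and no atom at 0.\<close>

lemma (in prob_space) AE_linear_combination_neq_0:
  assumes I: "finite I" "I \<noteq> {}" and ind: "indep_vars (\<lambda>_. borel) X I"
    and c: "\<And>i. i \<in> I \<Longrightarrow> c i \<noteq> 0"
    and X: "\<And>i. i \<in> I \<Longrightarrow> distributed M lborel (X i) std_normal_density"
  shows "AE \<omega> in M. (\<Sum>i\<in>I. c i * X i \<omega>) \<noteq> 0"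
proof -
  have "distributed M lborel (\<lambda>\<omega>. \<Sum>i\<in>I. c i * X i \<omega>)
      (normal_density (\<Sum>i\<in>I. 0) (sqrt (\<Sum>i\<in>I. \<bar>c i\<bar>\<^sup>2)))"
  proof (rule sum_indep_normal)
    show "indep_vars (\<lambda>_. borel) (\<lambda>i \<omega>. c i * X i \<omega>) I"
      using indep_vars_compose [OF ind, of "\<lambda>i x. c i * x" "\<lambda>_. borel"] by (simp add: comp_def)
    show "distributed M lborel (\<lambda>\<omega>. c i * X i \<omega>) (normal_density 0 \<bar>c i\<bar>)" if "i \<in> I" for i
      using normal_density_affine [OF X [OF that], of "c i" 0] c [OF that] by simp
  qed (use I c in auto)
  then have D: "distr M lborel (\<lambda>\<omega>. \<Sum>i\<in>I. c i * X i \<omega>)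
      = density lborel (normal_density (\<Sum>i\<in>I. 0) (sqrt (\<Sum>i\<in>I. \<bar>c i\<bar>\<^sup>2)))"
    and [measurable]: "(\<lambda>\<omega>. \<Sum>i\<in>I. c i * X i \<omega>) \<in> borel_measurable M"
    by (auto simp: distributed_def)
  have "AE x in distr M lborel (\<lambda>\<omega>. \<Sum>i\<in>I. c i * X i \<omega>). x \<noteq> 0"
    unfolding D using AE_lborel_singleton [of 0] by (simp add: AE_density) (auto elim: AE_mp)
  then show ?thesis
    by (simp add: AE_distr_iff)
qed

section \<open>The orthant, the product of \<open>Phi\<close>-factors and its Fourier
  representation\<close>

context
  fixes I :: "'i set" and u d :: "'i \<Rightarrow> real"
begin

text \<open>The indicator of the orthant \<open>C\<close>, written as a product so that Gaussian
  integrals over it factorise.\<close>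

definition orth :: "('i \<Rightarrow> real) \<Rightarrow> real" where
  "orth x = (\<Prod>j\<in>I. indicator {..0} (d j * x j))"

definition Phi_prod :: "real \<Rightarrow> complex" where
  "Phi_prod y = (\<Prod>j\<in>I. Phi (\<i> * complex_of_real (d j * (u j * y))))"

text \<open>The function \<psi> of the overview.\<close>

definition damped_prod :: "real \<Rightarrow> complex" where
  "damped_prod y = complex_of_real (exp (- (y\<^sup>2) / 2)) * Phi_prod y"

context
  assumes finite_I [simp, measurable]: "finite I" and card_I: "2 \<le> card I"
    and u_nz: "\<And>j. j \<in> I \<Longrightarrow> u j \<noteq> 0" and u_unit: "(\<Sum>j\<in>I. (u j)\<^sup>2) = 1"
    and d_sign: "\<And>j. j \<in> I \<Longrightarrow> \<bar>d j\<bar> = 1"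
begin

interpretation N: prob_space std_normal_distribution
  by (rule prob_space_std_normal_distribution)

interpretation G: prob_space "std_gauss I"
  by (rule prob_space_std_gauss)

text \<open>Coordinate \<open>j\<close> of the orthogonal component is a linear form with
  coefficients \<open>c l\<close>. Off the diagonal these are \<open>- u j * u l\<close>, hence
  nonzero; on the diagonal the coefficient is \<open>1 - (u j)^2\<close>, which is positive because
  a second index carries a nonzero part of the unit length. So the component almost surely avoids
  the boundary of the orthant.\<close>

lemma AE_orthogonal_component_neq_0:
  "AE x in std_gauss I. \<forall>j\<in>I. x j - proj_sum I u x * u j \<noteq> 0"
proof (subst AE_ball_countable [OF countable_finite], simp, intro ballI)
  fix j assume j: "j \<in> I"
  obtain i where i: "i \<in> I" "i \<noteq> j"
  proof -
    have "card (I - {j}) \<noteq> 0" using card_I j by simp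
    then have "I - {j} \<noteq> {}" by fastforce
    then show ?thesis using that by blast
  qed
  have "(\<Sum>l\<in>{i, j}. (u l)\<^sup>2) \<le> (\<Sum>l\<in>I. (u l)\<^sup>2)"
    using i j by (intro sum_mono2) auto
  then have "(u i)\<^sup>2 + (u j)\<^sup>2 \<le> 1" using i u_unit by simp
  moreover have "(u i)\<^sup>2 > 0" using u_nz i by simp
  ultimately have uj: "(u j)\<^sup>2 < 1" by linarith
  define c where "c l = (if l = j then 1 else 0) - u j * u l" for l
  have coord: "distr (std_gauss I) borel (\<lambda>x. x l) = std_normal_distribution" if "l \<in> I" for l
    using distr_PiM_component [of I "\<lambda>_. std_normal_distribution" l] that prob_space_std_normal_distribution
    by (simp cong: distr_cong)
  have "AE x in std_gauss I. (\<Sum>l\<in>I. c l * x l) \<noteq> 0"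
  proof (rule G.AE_linear_combination_neq_0)
    show "G.indep_vars (\<lambda>_. borel) (\<lambda>l x. x l) I"
    proof (subst G.indep_vars_iff_distr_eq_PiM')
      have "distr (std_gauss I) (PiM I (\<lambda>_. borel)) (\<lambda>x. \<lambda>l\<in>I. x l) = distr (std_gauss I) (std_gauss I) (\<lambda>x. x)"
        by (rule distr_cong) (auto simp: sets_std_gauss space_std_gauss extensional_restrict)
      also have "\<dots> = std_gauss I" by simp
      also have "\<dots> = PiM I (\<lambda>l. distr (std_gauss I) borel (\<lambda>x. x l))"
        by (rule PiM_cong) (simp_all add: coord)
      finally show "distr (std_gauss I) (PiM I (\<lambda>_. borel)) (\<lambda>x. \<lambda>l\<in>I. x l)
          = PiM I (\<lambda>l. distr (std_gauss I) borel (\<lambda>x. x l))" .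
    qed (use j in auto)
    show "distributed (std_gauss I) lborel (\<lambda>x. x l) std_normal_density" if "l \<in> I" for l
      using coord [OF that] that by (auto simp: distributed_def cong: distr_cong)
    show "c l \<noteq> 0" if "l \<in> I" for l
      using uj u_nz j that by (auto simp: c_def power2_eq_square)
  qed (use j in auto)
  moreover have "(\<Sum>l\<in>I. c l * x l) = x j - proj_sum I u x * u j" for x
  proof -
    have "(\<Sum>l\<in>I. c l * x l) = (\<Sum>l\<in>I. (if l = j then x l else 0) - u l * x l * u j)"
      by (intro sum.cong) (auto simp: c_def algebra_simps)
    also have "\<dots> = x j - proj_sum I u x * u j"
      using j by (simp add: sum_subtractf proj_sum_def flip: sum_distrib_right)
    finally show ?thesis .
  qed
  ultimately show "AE x in std_gauss I. x j - proj_sum I u x * u j \<noteq> 0" by simp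
qed

lemma orth_measurable [measurable]: "orth \<in> borel_measurable (PiM I (\<lambda>_. borel))"
  unfolding orth_def by measurable

lemma orth_bounds: "0 \<le> orth x" "orth x \<le> 1"
  unfolding orth_def by (auto intro!: prod_nonneg prod_le_1)

lemma orth_eq: "orth x = (if \<forall>j\<in>I. d j * x j \<le> 0 then 1 else 0)"
  unfolding orth_def by (auto simp: indicator_def prod_zero_iff)

lemma Phi_prod_measurable [measurable]: "Phi_prod \<in> borel_measurable borel"
  unfolding Phi_prod_def by measurable

lemma damped_prod_measurable [measurable]: "damped_prod \<in> borel_measurable borel"
  unfolding damped_prod_def by measurable

text \<open>Since the \<open>(u j)^2\<close> sum to 1, the damping \<open>exp (- y^2 / 2)\<close>
  splits into exactly the damping that each factor requires.\<close>

lemma damped_prod_eq_prod: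
  "damped_prod y = (\<Prod>j\<in>I. Phi (\<i> * complex_of_real (d j * (u j * y))) *
    complex_of_real (exp (- ((u j * y)\<^sup>2) / 2)))"
proof -
  have "(\<Prod>j\<in>I. exp (- ((u j * y)\<^sup>2) / 2)) = exp (\<Sum>j\<in>I. (u j)\<^sup>2 * (- (y\<^sup>2) / 2))"
    by (simp add: exp_sum power_mult_distrib)
  also have "\<dots> = exp (- (y\<^sup>2) / 2)"
    using u_unit unfolding sum_distrib_right [symmetric] by simp
  finally have "(\<Prod>j\<in>I. complex_of_real (exp (- ((u j * y)\<^sup>2) / 2))) = complex_of_real (exp (- (y\<^sup>2) / 2))"
    by (simp flip: of_real_prod)
  then show ?thesis
    by (simp add: damped_prod_def Phi_prod_def prod.distrib)
qed

text \<open>Each damped factor is a Fourier transform over a half-line; by independence of the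
  coordinates their product is the transform over the orthant, and the phases add up to
  \<open>- y * proj_sum I u x\<close>.\<close>

lemma damped_prod_eq_char:
  "damped_prod y = (LINT x|std_gauss I. orth x *\<^sub>R iexp (- (y * proj_sum I u x)))"
proof -
  interpret P: product_sigma_finite "\<lambda>_::'i. std_normal_distribution" ..
  let ?f = "\<lambda>j x. indicator {..0} (d j * x) *\<^sub>R exp (- (\<i> * complex_of_real (u j * y * x)))"
  have "damped_prod y = (\<Prod>j\<in>I. LINT x|std_normal_distribution. ?f j x)"
    unfolding damped_prod_eq_prod by (intro prod.cong refl Phi_signed_imaginary d_sign)
  also have "\<dots> = (LINT x|std_gauss I. (\<Prod>j\<in>I. ?f j (x j)))"
    by (intro P.product_integral_prod [symmetric] finite_I N.integrable_const_bound [where B = 1] AE_I2)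
       (auto simp: indicator_def)
  also have "(\<lambda>x. \<Prod>j\<in>I. ?f j (x j)) = (\<lambda>x. orth x *\<^sub>R iexp (- (y * proj_sum I u x)))"
    by (simp add: fun_eq_iff orth_def proj_sum_def scaleR_conv_of_real prod.distrib exp_sum [symmetric]
        sum_distrib_left sum_negf mult_ac)
  finally show ?thesis .
qed

text \<open>Two factors are bounded both by 1 and by a multiple of \<open>1 / \<bar>y\<bar>\<close>;
  all others are bounded by 1.\<close>

lemma norm_damped_prod_le:
  obtains K where "\<And>y. norm (damped_prod y) \<le> K * inverse (1 + y\<^sup>2)"
proof -
  obtain a b where ab: "a \<in> I" "b \<in> I" "a \<noteq> b"
    using card_I by (metis card_le_Suc0_iff_eq finite_I not_less_eq_eq numeral_2_eq_2)
  define f where "f j y = norm (Phi (\<i> * complex_of_real (d j * (u j * y))) *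
    complex_of_real (exp (- ((u j * y)\<^sup>2) / 2)))" for j y
  have f0: "0 \<le> f j y" for j y by (simp add: f_def)
  \<comment> \<open>As \<open>d j\<close> is a sign, the damping may be written at the same argument
    as \<open>Phi\<close>, which is the form of the two bounds.\<close>
  have sq: "(u j * y)\<^sup>2 = (d j * (u j * y))\<^sup>2" if "j \<in> I" for j y
    using d_sign [OF that] by (simp add: power_mult_distrib abs_square_eq_1)
  have f1: "f j y \<le> 1" if "j \<in> I" for j y
    unfolding f_def sq [OF that] by (rule norm_Phi_imaginary_le_1)
  have f2: "f j y \<le> 2 / \<bar>u j * y\<bar>" if "j \<in> I" "y \<noteq> 0" for j y
    using norm_Phi_imaginary_le [of "d j * (u j * y)"] that d_sign [OF that(1)] u_nz
    unfolding f_def sq [OF that(1)] by (auto simp: abs_mult)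
  have le: "norm (damped_prod y) \<le> f a y * f b y" for y
  proof -
    have "norm (damped_prod y) = (\<Prod>j\<in>I. f j y)"
      unfolding damped_prod_eq_prod f_def by (rule prod_norm [symmetric])
    also have "\<dots> = (\<Prod>j\<in>I - {a, b}. f j y) * (\<Prod>j\<in>{a, b}. f j y)"
      using ab by (intro prod.subset_diff) auto
    also have "\<dots> \<le> 1 * (\<Prod>j\<in>{a, b}. f j y)"
      by (intro mult_right_mono prod_le_1 prod_nonneg) (auto simp: f0 f1)
    finally show ?thesis using ab by simp
  qed
  show ?thesis
  proof (rule that)
    fix y :: real
    \<comment> \<open>The sum of the bounds for \<open>norm (damped_prod y)\<close> and for
      \<open>norm (damped_prod y) * y^2\<close>.\<close>
    let ?K = "1 + 4 / (\<bar>u a\<bar> * \<bar>u b\<bar>)"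
    have "norm (damped_prod y) \<le> 1"
      using le [of y] mult_le_one [OF f1 f0 f1, of a b y y] ab by linarith
    moreover have "norm (damped_prod y) * y\<^sup>2 \<le> 4 / (\<bar>u a\<bar> * \<bar>u b\<bar>)"
    proof (cases "y = 0")
      case False
      have "f a y * f b y \<le> 2 / \<bar>u a * y\<bar> * (2 / \<bar>u b * y\<bar>)"
        using ab False by (intro mult_mono f0 f2) auto
      with le [of y] have "norm (damped_prod y) * y\<^sup>2 \<le> 2 / \<bar>u a * y\<bar> * (2 / \<bar>u b * y\<bar>) * y\<^sup>2"
        by (intro mult_right_mono) auto
      also have "\<dots> = 4 / (\<bar>u a\<bar> * \<bar>u b\<bar>)"
        using False
        by (subst power2_abs [symmetric]) (simp add: abs_mult power2_eq_square del: abs_mult_self_eq)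
      finally show ?thesis .
    qed simp
    ultimately have "norm (damped_prod y) * (1 + y\<^sup>2) \<le> ?K"
      by (simp add: distrib_left)
    moreover have "0 < 1 + y\<^sup>2" by (simp add: add_pos_nonneg)
    ultimately show "norm (damped_prod y) \<le> ?K * inverse (1 + y\<^sup>2)"
      by (simp add: field_simps)
  qed
qed

lemma integrable_damped_prod: "integrable lborel damped_prod"
proof -
  obtain K where K: "\<And>y. norm (damped_prod y) \<le> K * inverse (1 + y\<^sup>2)"
    using norm_damped_prod_le by blast
  show ?thesis
  proof (rule Bochner_Integration.integrable_bound)
    show "integrable lborel (\<lambda>y. K * inverse (1 + y\<^sup>2) :: real)"
      using integrable_inverse_1_plus_square by (simp add: set_integrable_def)
    show "AE y in lborel. norm (damped_prod y) \<le> norm (K * inverse (1 + y\<^sup>2))"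
      using K by (intro AE_I2) (metis order.trans norm_ge_zero real_norm_def abs_ge_self)
  qed simp
qed

text \<open>The Gaussian weight of the expectation is itself the damping, so integrability of
  \<open>damped_prod\<close> gives that of \<open>Phi_prod\<close> under the normal law.\<close>

lemma density_Phi_prod:
  "std_normal_density y *\<^sub>R Phi_prod y = (1 / sqrt (2 * pi)) *\<^sub>R damped_prod y"
  by (simp add: std_normal_density_def damped_prod_def scaleR_conv_of_real)

lemma integrable_Phi_prod: "integrable std_normal_distribution Phi_prod"
  by (subst integrable_density)
     (auto simp: density_Phi_prod intro!: integrable_damped_prod)

lemma integral_Phi_prod:
  "(LINT y|std_normal_distribution. Phi_prod y) = (1 / sqrt (2 * pi)) *\<^sub>R (LINT y|lborel. damped_prod y)"
  by (subst integral_density) (auto simp: density_Phi_prod)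

section \<open>Gaussian smoothing and passage to the limit\<close>

lemma integral_damped_prod_scaled:
  "(LINT z|std_normal_distribution. damped_prod (c * z)) =
    complex_of_real (LINT x|std_gauss I. orth x * exp (- ((c * proj_sum I u x)\<^sup>2) / 2))"
proof -
  interpret pair_sigma_finite std_normal_distribution "std_gauss I" ..
  interpret GN: prob_space "std_normal_distribution \<Otimes>\<^sub>M std_gauss I"
    by (intro prob_space_pair N.prob_space_axioms G.prob_space_axioms)
  let ?f = "\<lambda>z x. orth x *\<^sub>R iexp (- (c * z * proj_sum I u x))"
  have "(LINT z|std_normal_distribution. damped_prod (c * z))
      = (LINT z|std_normal_distribution. LINT x|std_gauss I. ?f z x)"
    by (simp add: damped_prod_eq_char)
  also have "\<dots> = (LINT x|std_gauss I. LINT z|std_normal_distribution. ?f z x)"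
  proof (rule Fubini_integral [symmetric])
    show "integrable (std_normal_distribution \<Otimes>\<^sub>M std_gauss I) (\<lambda>(z, x). ?f z x)"
      by (rule GN.integrable_const_bound [where B = 1]) (auto simp: orth_bounds)
  qed
  \<comment> \<open>For fixed \<open>x\<close> the inner integral is the normal characteristic
    function at \<open>- c * proj_sum I u x\<close>; for large \<open>c\<close> the resulting weight
    concentrates near \<open>proj_sum I u x = 0\<close>.\<close>
  also have "\<dots> = (LINT x|std_gauss I. complex_of_real (orth x * exp (- ((c * proj_sum I u x)\<^sup>2) / 2)))"
  proof (rule Bochner_Integration.integral_cong [OF refl])
    fix x
    have "(LINT z|std_normal_distribution. ?f z x)
        = orth x *\<^sub>R (LINT z|std_normal_distribution. iexp ((- (c * proj_sum I u x)) * z))"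
      by (subst integral_scaleR_right [symmetric]) (simp add: mult_ac)
    also have "\<dots> = orth x *\<^sub>R char std_normal_distribution (- (c * proj_sum I u x))"
      by (simp add: char_def)
    finally show "(LINT z|std_normal_distribution. ?f z x)
        = complex_of_real (orth x * exp (- ((c * proj_sum I u x)\<^sup>2) / 2))"
      by (simp add: char_std_normal_distribution scaleR_conv_of_real)
  qed
  also have "\<dots> = complex_of_real (LINT x|std_gauss I. orth x * exp (- ((c * proj_sum I u x)\<^sup>2) / 2))"
    by (rule integral_complex_of_real)
  finally show ?thesis .
qed

text \<open>Substituting \<open>y = c z\<close> turns the left side into the integral of
  \<open>damped_prod\<close> against \<open>std_normal_density (y / c)\<close>, which tends to
  \<open>std_normal_density 0\<close>; dominated convergence applies because
  \<open>damped_prod\<close> is integrable. The scale \<open>Suc n\<close> is positive for every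
  \<open>n\<close>.\<close>

lemma scaled_integral_tendsto:
  "(\<lambda>n. complex_of_real (real (Suc n)) * (LINT z|std_normal_distribution. damped_prod (real (Suc n) * z)))
    \<longlonglongrightarrow> (LINT y|std_normal_distribution. Phi_prod y)"
proof -
  have scale: "complex_of_real c * (LINT z|std_normal_distribution. damped_prod (c * z))
      = (LINT y|lborel. std_normal_density (y / c) *\<^sub>R damped_prod y)"
    if "c > 0" for c
  proof -
    have "(LINT y|lborel. std_normal_density (y / c) *\<^sub>R damped_prod y)
       = c *\<^sub>R (LINT z|lborel. std_normal_density z *\<^sub>R damped_prod (c * z))"
      using that by (subst lborel_integral_real_affine [where c = c and t = 0]) auto
    then show ?thesis
      by (simp add: integral_density scaleR_conv_of_real)
  qed
  have "(\<lambda>n. LINT y|lborel. std_normal_density (y / real (Suc n)) *\<^sub>R damped_prod y)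
      \<longlonglongrightarrow> (LINT y|lborel. (1 / sqrt (2 * pi)) *\<^sub>R damped_prod y)"
  proof (rule integral_dominated_convergence)
    show "integrable lborel (\<lambda>y. norm (damped_prod y))"
      by (intro integrable_norm integrable_damped_prod)
    show "AE y in lborel. (\<lambda>n. std_normal_density (y / real (Suc n)) *\<^sub>R damped_prod y)
        \<longlonglongrightarrow> (1 / sqrt (2 * pi)) *\<^sub>R damped_prod y"
    proof (intro AE_I2 tendsto_scaleR tendsto_const)
      fix y :: real
      have "isCont std_normal_density 0"
        unfolding std_normal_density_def by (intro continuous_intros) auto
      moreover have "(\<lambda>n. y / real (Suc n)) \<longlonglongrightarrow> 0"
        by real_asymp
      ultimately have "(\<lambda>n. std_normal_density (y / real (Suc n))) \<longlonglongrightarrow> std_normal_density 0"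
        by (rule isCont_tendsto_compose)
      then show "(\<lambda>n. std_normal_density (y / real (Suc n))) \<longlonglongrightarrow> 1 / sqrt (2 * pi)"
        by (simp add: std_normal_density_def)
    qed
    fix n
    have "std_normal_density t \<le> 1" for t
    proof -
      have "1 / sqrt (2 * pi) * exp (- t\<^sup>2 / 2) \<le> 1 * 1"
        using pi_ge_two by (intro mult_mono) (auto simp: real_le_rsqrt)
      then show ?thesis by (simp add: std_normal_density_def)
    qed
    then show "AE y in lborel. norm (std_normal_density (y / real (Suc n)) *\<^sub>R damped_prod y) \<le> norm (damped_prod y)"
      by (intro AE_I2) (auto simp: mult_left_le_one_le)
  qed simp_all
  then show ?thesis
    unfolding scale [OF of_nat_0_less_iff [THEN iffD2, OF zero_less_Suc]] integral_Phi_prod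
    by simp
qed

text \<open>The splitting lemma replaces the coordinate along \<open>u\<close> by an independent
  normal \<open>s\<close>, and \<open>s = r / c\<close> absorbs the factor \<open>c\<close> into the
  Jacobian.\<close>

lemma scaled_orth_integral:
  assumes c: "c > 0"
  shows "ennreal (c * (LINT x|std_gauss I. orth x * exp (- ((c * proj_sum I u x)\<^sup>2) / 2)))
    = (\<integral>\<^sup>+x. \<integral>\<^sup>+r. ennreal (orth (\<lambda>j\<in>I. x j + (r / c - proj_sum I u x) * u j) * exp (- ((r / c)\<^sup>2) / 2))
        \<partial>std_normal_distribution \<partial>std_gauss I)"
proof -
  let ?T = "proj_sum I u"
  let ?h = "\<lambda>x s. \<lambda>j\<in>I. x j + (s - ?T x) * u j"
  define H where "H x = ennreal (c * (orth x * exp (- ((c * ?T x)\<^sup>2) / 2)))" for x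
  note [measurable] = measurable_proj_sum [OF finite_I]
  have H [measurable]: "H \<in> borel_measurable (PiM I (\<lambda>_. borel))"
    unfolding H_def by measurable
  have int: "integrable (std_gauss I) (\<lambda>x. orth x * exp (- ((c * ?T x)\<^sup>2) / 2))"
    by (rule G.integrable_const_bound [where B = 1])
       (auto simp: abs_mult orth_bounds intro!: mult_le_one)
  have T: "?T (?h x s) = s" for x s
    by (simp add: proj_sum_shift [OF u_unit])
  have "ennreal (c * (LINT x|std_gauss I. orth x * exp (- ((c * ?T x)\<^sup>2) / 2)))
      = ennreal (LINT x|std_gauss I. c * (orth x * exp (- ((c * ?T x)\<^sup>2) / 2)))"
    by simp
  also have "\<dots> = (\<integral>\<^sup>+x. H x \<partial>std_gauss I)"
    unfolding H_def using int c
    by (intro nn_integral_eq_integral [symmetric] integrable_mult_right) (auto simp: orth_bounds)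
  also have "\<dots> = (\<integral>\<^sup>+x. \<integral>\<^sup>+s. H (?h x s) \<partial>std_normal_distribution \<partial>std_gauss I)"
    by (rule nn_integral_std_gauss_split [OF finite_I u_unit H, symmetric])
  also have "\<dots> = (\<integral>\<^sup>+x. \<integral>\<^sup>+r. ennreal (orth (?h x (r / c)) * exp (- ((r / c)\<^sup>2) / 2))
        \<partial>std_normal_distribution \<partial>std_gauss I)"
  proof (rule nn_integral_cong)
    fix x
    have "(\<integral>\<^sup>+s. H (?h x s) \<partial>std_normal_distribution)
        = (\<integral>\<^sup>+s. ennreal (std_normal_density s) * H (?h x s) \<partial>lborel)"
      by (rule nn_integral_density) simp_all
    also have "\<dots> = ennreal (1 / c) * (\<integral>\<^sup>+r. ennreal (std_normal_density (r / c)) * H (?h x (r / c)) \<partial>lborel)"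
      using c by (subst nn_integral_real_affine [where c = "1 / c" and t = 0]) simp_all
    also have "\<dots> = (\<integral>\<^sup>+r. ennreal (1 / c) * (ennreal (std_normal_density (r / c)) * H (?h x (r / c))) \<partial>lborel)"
      by (rule nn_integral_cmult [symmetric]) simp
    also have "\<dots> = (\<integral>\<^sup>+r. ennreal (std_normal_density r) *
        ennreal (orth (?h x (r / c)) * exp (- ((r / c)\<^sup>2) / 2)) \<partial>lborel)"
    proof (rule nn_integral_cong)
      fix r :: real
      \<comment> \<open>The two Gaussian weights trade places: the smoothing factor at
        \<open>s = r / c\<close> becomes the density of \<open>r\<close>, and the density of
        \<open>s\<close> becomes the factor tending to 1.\<close>
      have "1 / c * (std_normal_density (r / c) * (c * (orth (?h x (r / c)) * exp (- ((c * (r / c))\<^sup>2) / 2))))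
          = std_normal_density r * (orth (?h x (r / c)) * exp (- ((r / c)\<^sup>2) / 2))"
        using c by (simp add: std_normal_density_def)
      then show "ennreal (1 / c) * (ennreal (std_normal_density (r / c)) * H (?h x (r / c)))
          = ennreal (std_normal_density r) * ennreal (orth (?h x (r / c)) * exp (- ((r / c)\<^sup>2) / 2))"
        using c unfolding H_def T by (simp add: orth_bounds flip: ennreal_mult)
    qed
    also have "\<dots> = (\<integral>\<^sup>+r. ennreal (orth (?h x (r / c)) * exp (- ((r / c)\<^sup>2) / 2)) \<partial>std_normal_distribution)"
      by (rule nn_integral_density [symmetric]) simp_all
    finally show "(\<integral>\<^sup>+s. H (?h x s) \<partial>std_normal_distribution)
        = (\<integral>\<^sup>+r. ennreal (orth (?h x (r / c)) * exp (- ((r / c)\<^sup>2) / 2)) \<partial>std_normal_distribution)" .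
  qed
  finally show ?thesis .
qed

text \<open>In the form of \<open>scaled_orth_integral\<close> the shift \<open>r / c\<close>
  disappears in the limit, and the orthant indicator converges wherever the orthogonal component
  misses the boundary.\<close>

lemma scaled_orth_integral_tendsto:
  "(\<lambda>n. real (Suc n) * (LINT x|std_gauss I. orth x * exp (- ((real (Suc n) * proj_sum I u x)\<^sup>2) / 2)))
    \<longlonglongrightarrow> measure (std_gauss I) {x \<in> space (std_gauss I). \<forall>j\<in>I. d j * (x j - proj_sum I u x * u j) \<le> 0}"
proof -
  let ?T = "proj_sum I u"
  let ?E = "{x \<in> space (std_gauss I). \<forall>j\<in>I. d j * (x j - ?T x * u j) \<le> 0}"
  let ?g = "\<lambda>n x r. ennreal (orth (\<lambda>j\<in>I. x j + (r / real (Suc n) - ?T x) * u j) * exp (- ((r / real (Suc n))\<^sup>2) / 2))"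
  note [measurable] = measurable_proj_sum [OF finite_I]
  have E [measurable]: "?E \<in> sets (std_gauss I)"
    by measurable
  have le1: "?g n x r \<le> 1" for n x r
    by (simp add: orth_bounds mult_le_one)
  have lim: "(\<lambda>n. ?g n x r) \<longlonglongrightarrow> indicator ?E x"
    if x: "x \<in> space (std_gauss I)" and nz: "\<forall>j\<in>I. x j - ?T x * u j \<noteq> 0" for x r
  proof -
    have small: "(\<lambda>n. r / real (Suc n)) \<longlonglongrightarrow> 0"
      by real_asymp
    have "(\<lambda>n. orth (\<lambda>j\<in>I. x j + (r / real (Suc n) - ?T x) * u j))
        \<longlonglongrightarrow> (\<Prod>j\<in>I. indicator {..0} (d j * (x j - ?T x * u j)))"
      unfolding orth_def
    proof (intro tendsto_prod)
      fix j assume j: "j \<in> I"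
      let ?a = "d j * (x j - ?T x * u j)"
      have a: "?a \<noteq> 0"
        using nz j d_sign [OF j] by auto
      \<comment> \<open>The indicator of a half-line is continuous away from its endpoint, which
        \<open>?a\<close> avoids by \<open>nz\<close>.\<close>
      have "isCont (indicator {..0} :: real \<Rightarrow> real) t" if "t \<noteq> 0" for t
        using that by (simp add: isCont_indicator frontier_def)
      from this [OF a] have "isCont (indicator {..0} :: real \<Rightarrow> real) ?a" .
      moreover have "(\<lambda>n. d j * (x j + (r / real (Suc n) - ?T x) * u j)) \<longlonglongrightarrow> d j * (x j + (0 - ?T x) * u j)"
        by (intro tendsto_intros small)
      then have "(\<lambda>n. d j * ((\<lambda>j\<in>I. x j + (r / real (Suc n) - ?T x) * u j) j)) \<longlonglongrightarrow> ?a"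
        using j by (simp del: of_nat_Suc)
      ultimately show "(\<lambda>n. indicator {..0} (d j * ((\<lambda>j\<in>I. x j + (r / real (Suc n) - ?T x) * u j) j)) :: real)
          \<longlonglongrightarrow> indicator {..0} ?a"
        by (intro isCont_tendsto_compose [where g = "indicator {..0}"]) simp_all
    qed
    moreover have "(\<lambda>n. exp (- ((r / real (Suc n))\<^sup>2) / 2)) \<longlonglongrightarrow> exp (- (0\<^sup>2) / 2)"
      by (intro tendsto_intros small) simp
    ultimately have "(\<lambda>n. ?g n x r) \<longlonglongrightarrow>
        ennreal ((\<Prod>j\<in>I. indicator {..0} (d j * (x j - ?T x * u j))) * exp (- (0\<^sup>2) / 2))"
      by (intro tendsto_ennrealI tendsto_mult)
    also have "ennreal ((\<Prod>j\<in>I. indicator {..0} (d j * (x j - ?T x * u j))) * exp (- (0\<^sup>2) / 2)) = indicator ?E x"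
      using orth_eq [of "\<lambda>j. x j - ?T x * u j", unfolded orth_def] x by (simp add: indicator_def)
    finally show ?thesis .
  qed
  \<comment> \<open>Dominated convergence is used twice, for the integral over \<open>x\<close> and,
    at almost every \<open>x\<close>, for the one over \<open>r\<close>; the majorant is the
    constant 1.\<close>
  have "(\<lambda>n. \<integral>\<^sup>+x. \<integral>\<^sup>+r. ?g n x r \<partial>std_normal_distribution \<partial>std_gauss I)
      \<longlonglongrightarrow> (\<integral>\<^sup>+x. indicator ?E x \<partial>std_gauss I)"
  proof (rule nn_integral_dominated_convergence [where w = "\<lambda>_. 1"])
    fix n
    have "(\<integral>\<^sup>+r. ?g n x r \<partial>std_normal_distribution) \<le> (\<integral>\<^sup>+r. 1 \<partial>std_normal_distribution)" for x
      by (intro nn_integral_mono le1)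
    then show "AE x in std_gauss I. (\<integral>\<^sup>+r. ?g n x r \<partial>std_normal_distribution) \<le> 1"
      using N.emeasure_space_1 by simp
    show "(\<lambda>x. \<integral>\<^sup>+r. ?g n x r \<partial>std_normal_distribution) \<in> borel_measurable (std_gauss I)"
      by measurable
  next
    show "AE x in std_gauss I. (\<lambda>n. \<integral>\<^sup>+r. ?g n x r \<partial>std_normal_distribution) \<longlonglongrightarrow> indicator ?E x"
      using AE_orthogonal_component_neq_0 AE_space
    proof eventually_elim
      case (elim x)
      have "(\<lambda>n. \<integral>\<^sup>+r. ?g n x r \<partial>std_normal_distribution)
          \<longlonglongrightarrow> (\<integral>\<^sup>+r. indicator ?E x \<partial>std_normal_distribution)"
      proof (rule nn_integral_dominated_convergence [where w = "\<lambda>_. 1"])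
        show "AE r in std_normal_distribution. ?g n x r \<le> 1" for n
          by (intro AE_I2 le1)
        show "AE r in std_normal_distribution. (\<lambda>n. ?g n x r) \<longlonglongrightarrow> indicator ?E x"
          by (intro AE_I2 lim elim)
      qed (use N.emeasure_space_1 in simp_all)
      then show ?case
        using N.emeasure_space_1 by simp
    qed
  qed (use G.emeasure_space_1 in auto)
  then have "(\<lambda>n. ennreal (real (Suc n) * (LINT x|std_gauss I. orth x * exp (- ((real (Suc n) * ?T x)\<^sup>2) / 2))))
      \<longlonglongrightarrow> ennreal (measure (std_gauss I) ?E)"
    unfolding scaled_orth_integral [OF of_nat_0_less_iff [THEN iffD2, OF zero_less_Suc]]
    by (simp add: G.emeasure_eq_measure del: of_nat_Suc)
  then show ?thesis
    by (subst (asm) tendsto_ennreal_iff)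
       (auto intro!: always_eventually mult_nonneg_nonneg integral_nonneg simp: orth_bounds)
qed

text \<open>The smoothed integrals have one limit on the Fourier side and one on the Gaussian side,
  so the limits agree.\<close>

lemma integral_Phi_prod_eq_measure:
  "(LINT y|std_normal_distribution. Phi_prod y) = complex_of_real
    (measure (std_gauss I) {x \<in> space (std_gauss I). \<forall>j\<in>I. d j * (x j - proj_sum I u x * u j) \<le> 0})"
proof (rule LIMSEQ_unique [OF scaled_integral_tendsto])
  show "(\<lambda>n. complex_of_real (real (Suc n)) * (LINT z|std_normal_distribution. damped_prod (real (Suc n) * z)))
    \<longlonglongrightarrow> complex_of_real (measure (std_gauss I) {x \<in> space (std_gauss I). \<forall>j\<in>I. d j * (x j - proj_sum I u x * u j) \<le> 0})"
    unfolding integral_damped_prod_scaled of_real_mult [symmetric]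
    by (intro tendsto_of_real scaled_orth_integral_tendsto)
qed

end

end

section \<open>Transfer to the given random vector\<close>

theorem corollary2:
  fixes M :: "'a measure" and g :: "nat \<Rightarrow> 'a \<Rightarrow> real"
    and v :: "nat \<Rightarrow> real" and m k :: nat
  assumes "m \<ge> 2" and "k \<in> {1..m}"
    and "\<And>j. j \<in> {1..m} \<Longrightarrow> v j \<noteq> 0"
    and "std_gaussian_vector M m g"
  defines "F \<equiv> (\<lambda>\<omega>.
      (\<Prod>l=1..k. Phi (\<i> * complex_of_real (g 1 \<omega> * \<bar>v l\<bar> / L2_set v {1..m}))) *
      (\<Prod>r=k+1..m. Phi (- \<i> * complex_of_real (g 1 \<omega> * \<bar>v r\<bar> / L2_set v {1..m}))))"
  shows "integrable M F \<and>
    complex_of_real (measure M {\<omega> \<in> space M.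
      (\<forall>l\<in>{1..k}. g l \<omega> / v l \<le> Sigma_avg m v (\<lambda>j. g j \<omega>)) \<and>
      (\<forall>r\<in>{k+1..m}. Sigma_avg m v (\<lambda>j. g j \<omega>) \<le> g r \<omega> / v r)})
    = integral\<^sup>L M F"
proof -
  interpret M: prob_space M
    using assms(4) by (simp add: std_gaussian_vector_def)
  have ind: "M.indep_vars (\<lambda>_. borel) g {1..m}"
    and g: "\<And>j. j \<in> {1..m} \<Longrightarrow> distributed M lborel (g j) std_normal_density"
    using assms(4) by (auto simp: std_gaussian_vector_def)
  have g_meas: "g j \<in> borel_measurable M" if "j \<in> {1..m}" for j
    using distributed_measurable [OF g [OF that]] by simp
  have g_distr: "distr M borel (g j) = std_normal_distribution" if "j \<in> {1..m}" for j
    using g [OF that] by (simp add: distributed_def cong: distr_cong)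
  define L where "L = L2_set v {1..m}"
  \<comment> \<open>The sign of the group of \<open>j\<close>: 1 for the first \<open>k\<close>
    indices, -1 for the rest. Multiplying by \<open>sgn (v j)\<close> in \<open>d\<close> gives
    \<open>d j * u j = e j * \<bar>v j\<bar> / L\<close>, the coefficient inside
    \<open>Phi\<close>.\<close>
  define e :: "nat \<Rightarrow> real" where "e j = (if j \<le> k then 1 else - 1)" for j
  define u where "u j = v j / L" for j
  define d where "d j = e j * sgn (v j)" for j
  have L_sq: "L\<^sup>2 = (\<Sum>j=1..m. (v j)\<^sup>2)"
    unfolding L_def L2_set_def by (simp add: sum_nonneg)
  have "0 < (v 1)\<^sup>2" using assms(1,3) by simp
  also have "(v 1)\<^sup>2 \<le> (\<Sum>j=1..m. (v j)\<^sup>2)"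
    using assms(1) by (intro member_le_sum) auto
  finally have "L \<noteq> 0" using L_sq by auto
  moreover have "0 \<le> L" by (simp add: L_def)
  ultimately have L: "0 < L" by simp
  have u_unit: "(\<Sum>j\<in>{1..m}. (u j)\<^sup>2) = 1"
  proof -
    have "(\<Sum>j\<in>{1..m}. (u j)\<^sup>2) = (\<Sum>j=1..m. (v j)\<^sup>2) / L\<^sup>2"
      by (simp add: u_def power_divide sum_divide_distrib)
    then show ?thesis
      unfolding L_sq [symmetric] using L by simp
  qed
  have u_nz: "u j \<noteq> 0" if "j \<in> {1..m}" for j
    using assms(3) [OF that] L by (simp add: u_def)
  have d_sign: "\<bar>d j\<bar> = 1" if "j \<in> {1..m}" for j
    using assms(3) [OF that] by (auto simp: d_def e_def abs_mult abs_sgn_eq)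
  have card: "2 \<le> card {1..m}" using assms(1) by simp
  let ?P = "Phi_prod {1..m} u d"
  have F: "F \<omega> = ?P (g 1 \<omega>)" for \<omega>
  proof -
    have du: "d j * (u j * y) = e j * (y * \<bar>v j\<bar> / L)" for j y
      by (simp add: d_def u_def abs_sgn mult_ac)
    have split: "{1..m} = {1..k} \<union> {k+1..m}"
      using assms(2) by auto
    have "?P (g 1 \<omega>) = (\<Prod>j=1..k. Phi (\<i> * complex_of_real (d j * (u j * g 1 \<omega>)))) *
        (\<Prod>j=k+1..m. Phi (\<i> * complex_of_real (d j * (u j * g 1 \<omega>))))"
      unfolding Phi_prod_def split by (rule prod.union_disjoint) auto
    then show ?thesis
      unfolding F_def du L_def [symmetric] by (simp add: e_def)
  qed
  have one: "1 \<in> {1..m}" using assms(1) by simp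
  have P_meas: "?P \<in> borel_measurable borel"
    by (rule Phi_prod_measurable) (use card u_nz u_unit d_sign in auto)
  have "integrable (distr M borel (g 1)) ?P"
    unfolding g_distr [OF one]
    by (rule integrable_Phi_prod) (use card u_nz u_unit d_sign in auto)
  then have int_F: "integrable M F"
    unfolding F [abs_def] by (simp only: integrable_distr_eq [OF g_meas [OF one] P_meas])
  let ?X = "\<lambda>\<omega>. \<lambda>j\<in>{1..m}. g j \<omega>"
  let ?E = "{x \<in> space (std_gauss {1..m}). \<forall>j\<in>{1..m}. d j * (x j - proj_sum {1..m} u x * u j) \<le> 0}"
  have X: "?X \<in> measurable M (PiM {1..m} (\<lambda>_. borel))"
    by (rule measurable_restrict) (rule g_meas)
  \<comment> \<open>Independence means that the joint law is the product of the marginals, here the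
    standard Gaussian measure.\<close>
  have "distr M (PiM {1..m} (\<lambda>_. borel)) ?X = PiM {1..m} (\<lambda>j. distr M borel (g j))"
    using ind one by (subst (asm) M.indep_vars_iff_distr_eq_PiM') (auto intro: g_meas)
  also have "\<dots> = std_gauss {1..m}"
    by (rule PiM_cong) (simp_all add: g_distr)
  finally have X_distr: "distr M (PiM {1..m} (\<lambda>_. borel)) ?X = std_gauss {1..m}" .
  note [measurable] = measurable_proj_sum [OF finite_atLeastAtMost [of 1 m]]
  have E: "?E \<in> sets (PiM {1..m} (\<lambda>_. borel))"
    unfolding sets_std_gauss [symmetric] by measurable
  have "integral\<^sup>L M F = (LINT y|distr M borel (g 1). ?P y)"
    unfolding F [abs_def] by (rule integral_distr [OF g_meas [OF one] P_meas, symmetric])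
  also have "\<dots> = complex_of_real (measure (std_gauss {1..m}) ?E)"
    unfolding g_distr [OF one]
    by (rule integral_Phi_prod_eq_measure) (use card u_nz u_unit d_sign in auto)
  also have "measure (std_gauss {1..m}) ?E = measure (distr M (PiM {1..m} (\<lambda>_. borel)) ?X) ?E"
    unfolding X_distr ..
  also have "\<dots> = measure M (?X -` ?E \<inter> space M)"
    by (rule measure_distr [OF X E])
  also have "?X -` ?E \<inter> space M = {\<omega> \<in> space M.
      (\<forall>l\<in>{1..k}. g l \<omega> / v l \<le> Sigma_avg m v (\<lambda>j. g j \<omega>)) \<and>
      (\<forall>r\<in>{k+1..m}. Sigma_avg m v (\<lambda>j. g j \<omega>) \<le> g r \<omega> / v r)}"
  proof -
    have cond: "d j * (?X \<omega> j - proj_sum {1..m} u (?X \<omega>) * u j) \<le> 0 \<longleftrightarrow>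
        (if j \<le> k then g j \<omega> / v j \<le> Sigma_avg m v (\<lambda>j. g j \<omega>)
         else Sigma_avg m v (\<lambda>j. g j \<omega>) \<le> g j \<omega> / v j)" if j: "j \<in> {1..m}" for j \<omega>
    proof -
      let ?S = "Sigma_avg m v (\<lambda>j. g j \<omega>)"
      have "proj_sum {1..m} u (?X \<omega>) = L * ?S"
        unfolding proj_sum_def Sigma_avg_def L_def [symmetric] sum_distrib_left
        by (intro sum.cong) (use L in \<open>auto simp: u_def power2_eq_square\<close>)
      then have "d j * (?X \<omega> j - proj_sum {1..m} u (?X \<omega>) * u j) = d j * (g j \<omega> - v j * ?S)"
        using j L by (simp add: u_def mult_ac)
      \<comment> \<open>With the positive factor \<open>\<bar>v j\<bar>\<close> extracted, the sign
        \<open>e j\<close> decides the direction of the inequality.\<close>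
      also have "\<dots> = \<bar>v j\<bar> * (e j * (g j \<omega> / v j - ?S))"
        using assms(3) [OF j] by (simp add: d_def sgn_if abs_if field_simps)
      finally show ?thesis
        using assms(3) [OF j] by (auto simp: e_def mult_le_0_iff)
    qed
    have "?X -` ?E \<inter> space M = {\<omega> \<in> space M. \<forall>j\<in>{1..m}. d j * (?X \<omega> j - proj_sum {1..m} u (?X \<omega>) * u j) \<le> 0}"
      by (auto simp: space_std_gauss)
    also have "\<dots> = {\<omega> \<in> space M. \<forall>j\<in>{1..m}. if j \<le> k then g j \<omega> / v j \<le> Sigma_avg m v (\<lambda>j. g j \<omega>)
         else Sigma_avg m v (\<lambda>j. g j \<omega>) \<le> g j \<omega> / v j}"
      using cond by simp
    also have "\<dots> = {\<omega> \<in> space M.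
      (\<forall>l\<in>{1..k}. g l \<omega> / v l \<le> Sigma_avg m v (\<lambda>j. g j \<omega>)) \<and>
      (\<forall>r\<in>{k+1..m}. Sigma_avg m v (\<lambda>j. g j \<omega>) \<le> g r \<omega> / v r)}"
      using assms(2) by (intro Collect_cong conj_cong refl) (force split: if_splits)
    finally show ?thesis .
  qed
  finally show ?thesis
    using int_F by simp
qed

end
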